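(* Consider the time-varying nonlinear discrete-time system $x(i+1)=f(i,x(i))$, $i=0,1,2,\dots$, where $f$ is continuously differentiable with respect to $x$, with Jacobian $J(i,x):=\frac{\partial}{\partial x}f(i,x)$, and whose trajectories evolve on a convex and compact set $\Omega\subset\mathbb{R}^n$ (that is, $f(i,\Omega)\subseteq\Omega$ for all $i\ge 0$). Suppose that: (a) the matrix $\int_0^1 J(i,ra+(1-r)b)\,\mathrm{d}r$ is totally positive for any $a,b\in\Omega$ and any $i\ge 0$; (b) there is an integer $T>0$ such that $f(i+T,a)=f(i,a)$ for all $a\in\Omega$ and all $i\ge 0$. Then for any $a\in\Omega$ the solution $x(i,a)$ with $x(0,a)=a$ converges to a $T$-periodic solution as $i\to\infty$; that is, there is a solution $y(i)$ of the system in $\Omega$ with $y(i+T)=y(i)$ for all $i\ge 0$ and $x(i,a)-y(i)\to 0$ as $i\to\infty$.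
   Context: A matrix is totally positive (TP) if all its minors (of all orders) are positive. Here each $f(i,\cdot)$ is taken to be an $\mathbb{R}^n$-valued, continuously differentiable map on an open set containing $\Omega$. *)

theory Defs
  imports "HOL-Analysis.Analysis" "Jordan_Normal_Form.Determinant"
begin

no_notation Matrix.vec_index (infixl "$" 100)

text \<open>
  The matrices are indexed by finite linearly ordered types; the order on the index type
  is what fixes the sign of a minor. The empty minor is excluded, although it equals 1.
\<close>

definition minor ::
  "real ^ 'n::{finite,linorder} ^ 'm::{finite,linorder} \<Rightarrow> 'm set \<Rightarrow> 'n set \<Rightarrow> real" where
  "minor A R C =
     Determinant.det (Matrix.mat (card R) (card C)
       (\<lambda>(p, q). A $ (sorted_list_of_set R ! p) $ (sorted_list_of_set C ! q)))"

definition totally_positive :: "real ^ 'n::{finite,linorder} ^ 'm::{finite,linorder} \<Rightarrow> bool" where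
  "totally_positive A \<longleftrightarrow>
     (\<forall>R C. R \<noteq> {} \<and> C \<noteq> {} \<and> card R = card C \<longrightarrow> minor A R C > 0)"

definition C1_around :: "(real ^ 'n \<Rightarrow> real ^ 'm) \<Rightarrow> (real ^ 'n) set \<Rightarrow> bool" where
  "C1_around g S \<longleftrightarrow>
     (\<exists>U. open U \<and> S \<subseteq> U \<and> (\<forall>x\<in>U. g differentiable (at x)) \<and>
          continuous_on U (\<lambda>x. jacobian g (at x)))"

definition is_solution :: "(nat \<Rightarrow> 'a \<Rightarrow> 'a) \<Rightarrow> (nat \<Rightarrow> 'a) \<Rightarrow> bool" where
  "is_solution f x \<longleftrightarrow> (\<forall>i. x (Suc i) = f i (x i))"

primrec trajectory :: "(nat \<Rightarrow> 'a \<Rightarrow> 'a) \<Rightarrow> 'a \<Rightarrow> nat \<Rightarrow> 'a" where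
  "trajectory f a 0 = a"
| "trajectory f a (Suc i) = f i (trajectory f a i)"

lemma minor_singleton: "minor A {i} {j} = A $ i $ j"
  by (simp add: minor_def Determinant.det_single)

lemma is_solution_iff_trajectory: "is_solution f x \<longleftrightarrow> x = trajectory f (x 0)"
proof
  assume sol: "is_solution f x"
  have "x i = trajectory f (x 0) i" for i
    using sol by (induction i) (simp_all add: is_solution_def)
  then show "x = trajectory f (x 0)" by blast
next
  assume "x = trajectory f (x 0)"
  then show "is_solution f x"
    unfolding is_solution_def by (metis trajectory.simps(2))
qed

end

theory Submission
  imports Defs
begin

text \<open>Differences of two solutions obey \<open>d (i + 1) = A\<^sub>i d i\<close> with \<open>A\<^sub>i\<close> the averaged Jacobian, which is
  totally positive. Such matrices do not increase the number of sign changes, and once this number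
  has settled along \<open>d\<close>, the first coordinate of \<open>d\<close> is nonzero and has a constant sign. For the
  solution through \<open>a\<close> and its shift by \<open>T\<close> this makes the first coordinate monotone along the orbit
  of the period map; for two points of the limit set of that orbit it forces equality. So the limit
  set is one fixed point of the period map, and its solution is the periodic one.\<close>

section \<open>Determinants of totally positive matrices\<close>

lemma sorted_list_of_set_image_strict_mono:
  fixes r :: "nat \<Rightarrow> 'a::linorder"
  assumes "strict_mono_on {..<M} r"
  shows "sorted_list_of_set (r ` {..<M}) = map r [0..<M]"
proof (rule sorted_distinct_set_unique)
  show "sorted (map r [0..<M])"
    using strict_mono_onD[OF assms]
    by (simp add: sorted_iff_nth_mono_less less_imp_le del: sorted_map)
  show "distinct (map r [0..<M])"
    using strict_mono_on_imp_inj_on[OF assms] by (simp add: distinct_map atLeast0LessThan)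
qed (auto simp: atLeast0LessThan)

lemma minor_image_strict_mono:
  fixes A :: "real ^ 'n::{finite,linorder} ^ 'm::{finite,linorder}"
  assumes r: "strict_mono_on {..<M} r" and c: "strict_mono_on {..<M} c"
  shows "minor A (r ` {..<M}) (c ` {..<M}) =
    Determinant.det (Matrix.mat M M (\<lambda>(p, q). A $ r p $ c q))"
proof -
  have cards: "card (r ` {..<M}) = M" "card (c ` {..<M}) = M"
    by (simp_all add: card_image strict_mono_on_imp_inj_on[OF r] strict_mono_on_imp_inj_on[OF c])
  show ?thesis
    unfolding minor_def cards sorted_list_of_set_image_strict_mono[OF r]
      sorted_list_of_set_image_strict_mono[OF c]
    by (rule arg_cong[where f = Determinant.det]) auto
qed

text \<open>The empty determinant is 1, so \<open>M = 0\<close> is allowed although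
  \<open>totally_positive\<close> speaks only of nonempty minors. This later covers deleting the
  only row and column of a 1 by 1 matrix.\<close>

lemma totally_positive_det_pos:
  fixes A :: "real ^ 'n::{finite,linorder} ^ 'm::{finite,linorder}"
  assumes "totally_positive A" "strict_mono_on {..<M} r" "strict_mono_on {..<M} c"
  shows "Determinant.det (Matrix.mat M M (\<lambda>(p, q). A $ r p $ c q)) > 0"
proof (cases "M = 0")
  case True
  then show ?thesis by (simp)
next
  case False
  have "card (r ` {..<M}) = card (c ` {..<M})"
    using assms(2,3) by (simp add: card_image strict_mono_on_imp_inj_on)
  then show ?thesis
    using False assms(1) unfolding minor_image_strict_mono[OF assms(2,3), symmetric]
      totally_positive_def by (simp add: lessThan_empty_iff)
qed

text \<open>Laplace expansion along column \<open>t\<close>: the cofactors there do not depend on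
  the entries of that column, so the determinant is linear in it.\<close>

lemma det_column_sum:
  fixes g :: "nat \<Rightarrow> nat \<Rightarrow> 'a::comm_ring_1"
  assumes t: "t < M"
  shows "Determinant.det (Matrix.mat M M (\<lambda>(p, q). if q = t then \<Sum>j\<in>S. l j * v j p else g p q)) =
    (\<Sum>j\<in>S. l j * Determinant.det (Matrix.mat M M (\<lambda>(p, q). if q = t then v j p else g p q)))"
proof -
  define B where "B u = Matrix.mat M M (\<lambda>(p, q). if q = t then u p else g p q)" for u :: "nat \<Rightarrow> 'a"
  define C where "C p = cofactor (B (\<lambda>_. 0)) p t" for p
  have "cofactor (B u) p t = C p" if "p < M" for u p
  proof -
    have "mat_delete (B u) p t = mat_delete (B (\<lambda>_. 0)) p t"
      unfolding mat_delete_def B_def using that t by auto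
    then show ?thesis by (simp add: C_def cofactor_def)
  qed
  then have expand: "Determinant.det (B u) = (\<Sum>p<M. u p * C p)" for u
    using laplace_expansion_column[of "B u" M t] t by (simp add: B_def)
  have "Determinant.det (B (\<lambda>p. \<Sum>j\<in>S. l j * v j p)) =
      (\<Sum>j\<in>S. l j * Determinant.det (B (v j)))"
    unfolding expand sum_distrib_left sum_distrib_right
    by (subst sum.swap) (simp add: mult.assoc)
  then show ?thesis by (simp add: B_def)
qed

lemma totally_positive_det_blocks_pos:
  fixes A :: "real ^ 'n::{finite,linorder} ^ 'm::{finite,linorder}" and X :: "nat \<Rightarrow> 'n set"
  assumes TP: "totally_positive A" and r: "strict_mono_on {..<M} r"
    and ord: "\<And>q q' j j'. q < q' \<Longrightarrow> q' < M \<Longrightarrow> j \<in> X q \<Longrightarrow> j' \<in> X q' \<Longrightarrow> j < j'"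
    and ne: "\<And>q. q < M \<Longrightarrow> X q \<noteq> {}"
    and pos: "\<And>q j. q < M \<Longrightarrow> j \<in> X q \<Longrightarrow> l j > 0"
  shows "Determinant.det (Matrix.mat M M (\<lambda>(p, q). \<Sum>j\<in>X q. l j * A $ r p $ j)) > 0"
proof -
  \<comment> \<open>Replace single columns by block sums one at a time; each replacement turns the determinant
    into a positive combination of determinants of the previous kind.\<close>
  define B where "B t c = Matrix.mat M M (\<lambda>(p, q).
    if q < t then \<Sum>j\<in>X q. l j * A $ r p $ j else A $ r p $ c q)" for t :: nat and c
  have "Determinant.det (B t c) > 0" if "t \<le> M" "\<And>q. t \<le> q \<Longrightarrow> q < M \<Longrightarrow> c q \<in> X q" for t c
    using that
  proof (induction t arbitrary: c)
    case 0
    then have "strict_mono_on {..<M} c"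
      by (auto intro!: strict_mono_onI ord)
    from totally_positive_det_pos[OF TP r this] show ?case by (simp add: B_def)
  next
    case (Suc t)
    have t: "t < M" using Suc.prems by simp
    let ?g = "\<lambda>p q. if q < t then \<Sum>j\<in>X q. l j * A $ r p $ j else A $ r p $ c q"
    have "B (Suc t) c =
        Matrix.mat M M (\<lambda>(p, q). if q = t then \<Sum>j\<in>X t. l j * A $ r p $ j else ?g p q)"
      unfolding B_def by (auto simp: less_Suc_eq)
    moreover have "B t (c(t := j)) =
        Matrix.mat M M (\<lambda>(p, q). if q = t then A $ r p $ j else ?g p q)" for j
      unfolding B_def by auto
    ultimately have eq: "Determinant.det (B (Suc t) c) =
        (\<Sum>j\<in>X t. l j * Determinant.det (B t (c(t := j))))"
      by (simp add: det_column_sum[OF t])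
    show ?case unfolding eq
    proof (rule sum_pos)
      show "0 < l j * Determinant.det (B t (c(t := j)))" if "j \<in> X t" for j
        by (rule mult_pos_pos[OF pos[OF t that] Suc.IH]) (use that Suc.prems in auto)
    qed (use ne[OF t] in auto)
  qed
  \<comment> \<open>At \<open>t = M\<close> no column is left for \<open>c\<close> to choose, so any
    \<open>c\<close> will do.\<close>
  from this[of M undefined] have "Determinant.det (B M undefined) > 0" by simp
  also have "B M undefined = Matrix.mat M M (\<lambda>(p, q). \<Sum>j\<in>X q. l j * A $ r p $ j)"
    unfolding B_def by auto
  finally show ?thesis .
qed

section \<open>Sign alternations and sign blocks\<close>

text \<open>The \<open>m + 1\<close> chosen entries show \<open>m\<close> sign changes. For a
  nonzero vector, the largest \<open>m\<close> over \<open>s = 1\<close> and \<open>s = -1\<close>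
  is the number of sign changes with zeros discarded. Keeping \<open>s\<close> records the sign at
  which the alternation starts, not only its length.\<close>

definition strict_alternation :: "('n::linorder \<Rightarrow> real) \<Rightarrow> nat \<Rightarrow> real \<Rightarrow> bool" where
  "strict_alternation v m s \<longleftrightarrow>
     (\<exists>r. strict_mono_on {..m} r \<and> (\<forall>k\<le>m. s * (-1) ^ k * v (r k) > 0))"

text \<open>Zeros may count as either sign here, so for a vector the largest \<open>m\<close> over
  \<open>s = 1\<close> and \<open>s = -1\<close> is the number of sign changes after filling in the
  zeros to maximise it.\<close>

definition weak_alternation :: "('n::linorder \<Rightarrow> real) \<Rightarrow> nat \<Rightarrow> real \<Rightarrow> bool" where
  "weak_alternation v m s \<longleftrightarrow>
     (\<exists>r. strict_mono_on {..m} r \<and> (\<forall>k\<le>m. s * (-1) ^ k * v (r k) \<ge> 0))"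

lemma strict_alternation_imp_weak: "strict_alternation v m s \<Longrightarrow> weak_alternation v m s"
  unfolding strict_alternation_def weak_alternation_def by (meson less_imp_le)

lemma strict_alternation_le:
  "strict_alternation v m s \<Longrightarrow> m' \<le> m \<Longrightarrow> strict_alternation v m' s"
  unfolding strict_alternation_def
  by (meson atMost_subset_iff order_trans monotone_on_subset)

lemma weak_alternation_le:
  "weak_alternation v m s \<Longrightarrow> m' \<le> m \<Longrightarrow> weak_alternation v m' s"
  unfolding weak_alternation_def
  by (meson atMost_subset_iff order_trans monotone_on_subset)

lemma strict_alternation_tail:
  assumes "strict_alternation v (Suc m) s"
  shows "strict_alternation v m (- s)"
proof -
  from assms obtain r where r: "strict_mono_on {..Suc m} r"
    "\<forall>k\<le>Suc m. s * (-1) ^ k * v (r k) > 0" unfolding strict_alternation_def by blast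
  have "strict_mono_on {..m} (r \<circ> Suc)"
    using r(1) by (auto intro!: strict_mono_onI dest: strict_mono_onD)
  moreover have "- s * (-1) ^ k * v ((r \<circ> Suc) k) > 0" if "k \<le> m" for k
    using r(2)[rule_format, of "Suc k"] that by simp
  ultimately show ?thesis unfolding strict_alternation_def by blast
qed

lemma weak_alternation_tail:
  assumes "weak_alternation v (Suc m) s"
  shows "weak_alternation v m (- s)"
proof -
  from assms obtain r where r: "strict_mono_on {..Suc m} r"
    "\<forall>k\<le>Suc m. s * (-1) ^ k * v (r k) \<ge> 0" unfolding weak_alternation_def by blast
  have "strict_mono_on {..m} (r \<circ> Suc)"
    using r(1) by (auto intro!: strict_mono_onI dest: strict_mono_onD)
  moreover have "- s * (-1) ^ k * v ((r \<circ> Suc) k) \<ge> 0" if "k \<le> m" for k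
    using r(2)[rule_format, of "Suc k"] that by simp
  ultimately show ?thesis unfolding weak_alternation_def by blast
qed

lemma strict_alternation_less_card:
  fixes v :: "'n::{finite,linorder} \<Rightarrow> real"
  assumes "strict_alternation v m s"
  shows "m < CARD('n)"
proof -
  from assms obtain r :: "nat \<Rightarrow> 'n" where "strict_mono_on {..m} r"
    unfolding strict_alternation_def by blast
  then have "card (r ` {..m}) = Suc m" by (simp add: card_image strict_mono_on_imp_inj_on)
  moreover have "card (r ` {..m}) \<le> CARD('n)" by (rule card_mono) auto
  ultimately show ?thesis by simp
qed

text \<open>With \<open>S\<close> the support of \<open>v\<close>, the \<open>X q\<close> are its
  maximal runs of constant sign in index order. Leaving \<open>S\<close> free allows induction on
  it.\<close>

definition sign_blocks :: "('n::linorder \<Rightarrow> real) \<Rightarrow> 'n set \<Rightarrow> nat \<Rightarrow> (nat \<Rightarrow> 'n set) \<Rightarrow> real \<Rightarrow> bool"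
  where
  "sign_blocks v S m X s \<longleftrightarrow>
     (s = 1 \<or> s = -1) \<and> S = (\<Union>q\<le>m. X q) \<and> (\<forall>q\<le>m. X q \<noteq> {}) \<and>
     (\<forall>q q'. q < q' \<longrightarrow> q' \<le> m \<longrightarrow> (\<forall>j\<in>X q. \<forall>j'\<in>X q'. j < j')) \<and>
     (\<forall>q\<le>m. \<forall>j\<in>X q. s * (-1) ^ q * v j > 0)"

text \<open>Indices are added in increasing order: a new largest index joins the last block if the
  signs agree, and otherwise opens a new block.\<close>

lemma sign_blocks_exist:
  fixes v :: "'n::linorder \<Rightarrow> real"
  assumes "finite S" "S \<noteq> {}" "\<forall>j\<in>S. v j \<noteq> 0"
  shows "\<exists>m X s. sign_blocks v S m X s"
  using assms
proof (induction S rule: finite_linorder_max_induct)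
  case empty
  then show ?case by simp
next
  case (insert b S)
  show ?case
  proof (cases "S = {}")
    case True
    then have "sign_blocks v (insert b S) 0 (\<lambda>_. {b}) (sgn (v b))"
      using insert.prems by (auto simp: sign_blocks_def sgn_if)
    then show ?thesis by blast
  next
    case False
    from insert.prems have "\<forall>j\<in>S. v j \<noteq> 0" by blast
    from insert.IH[OF False this] obtain m X s where blocks: "sign_blocks v S m X s"
      by blast
    then have s: "s = 1 \<or> s = -1" and S: "S = (\<Union>q\<le>m. X q)"
      and ne: "\<forall>q\<le>m. X q \<noteq> {}"
      and ord: "\<forall>q q'. q < q' \<longrightarrow> q' \<le> m \<longrightarrow> (\<forall>j\<in>X q. \<forall>j'\<in>X q'. j < j')"
      and sgn: "\<forall>q\<le>m. \<forall>j\<in>X q. s * (-1) ^ q * v j > 0"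
      unfolding sign_blocks_def by blast+
    have b: "j < b" if "q \<le> m" "j \<in> X q" for q j using insert.hyps(2) S that by auto
    have "v b \<noteq> 0" using insert.prems by simp
    with s consider "s * (-1) ^ m * v b > 0" | "s * (-1) ^ Suc m * v b > 0"
      by (cases "even m") (auto simp: zero_less_mult_iff linorder_neq_iff)
    then show ?thesis
    proof cases
      case 1
      have "sign_blocks v (insert b S) m (X(m := insert b (X m))) s"
        unfolding sign_blocks_def
      proof (intro conjI)
        show "insert b S = (\<Union>q\<le>m. (X(m := insert b (X m))) q)"
          unfolding S by (auto split: if_splits)
      qed (use s ne ord b b[OF less_imp_le] sgn 1 in auto)
      then show ?thesis by blast
    next
      case 2
      have "sign_blocks v (insert b S) (Suc m) (X(Suc m := {b})) s"
        unfolding sign_blocks_def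
      proof (intro conjI)
        show "insert b S = (\<Union>q\<le>Suc m. (X(Suc m := {b})) q)"
          unfolding S by (auto simp: le_Suc_eq)
      qed (use s ne ord b b[OF less_imp_le] b[OF order_refl] sgn 2 in \<open>auto simp: le_Suc_eq less_Suc_eq\<close>)
      then show ?thesis by blast
    qed
  qed
qed

lemma strict_alternation_of_sign_blocks:
  fixes v :: "'n::linorder \<Rightarrow> real"
  assumes "sign_blocks v S m X s"
  shows "strict_alternation v m s"
proof -
  from assms have "\<forall>q\<le>m. \<exists>j. j \<in> X q" unfolding sign_blocks_def by blast
  then obtain r where "\<forall>q\<le>m. r q \<in> X q" by metis
  with assms show ?thesis
    unfolding strict_alternation_def sign_blocks_def
    by (intro exI[of _ r]) (auto intro!: strict_mono_onI)
qed

section \<open>Totally positive matrices and sign changes\<close>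

text \<open>Zero entries drop out, the blocks are disjoint, and the sign of \<open>v\<close> is
  constant on each block, so it factors out and the absolute values remain as weights.\<close>

lemma sum_over_sign_blocks:
  fixes v :: "'n::{finite,linorder} \<Rightarrow> real"
  assumes blocks: "sign_blocks v {j. v j \<noteq> 0} m X s"
  shows "(\<Sum>j\<in>UNIV. a j * v j) = (\<Sum>q<Suc m. s * (-1) ^ q * (\<Sum>j\<in>X q. \<bar>v j\<bar> * a j))"
proof -
  have s: "s = 1 \<or> s = -1" and supp: "{j. v j \<noteq> 0} = (\<Union>q\<le>m. X q)"
    and ord: "\<And>q q' j j'. q < q' \<Longrightarrow> q' \<le> m \<Longrightarrow> j \<in> X q \<Longrightarrow> j' \<in> X q' \<Longrightarrow> j < j'"
    and sgn: "\<And>q j. q \<le> m \<Longrightarrow> j \<in> X q \<Longrightarrow> s * (-1) ^ q * v j > 0"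
    using blocks unfolding sign_blocks_def by blast+
  have v: "v j = s * (-1) ^ q * \<bar>v j\<bar>" if "q \<le> m" "j \<in> X q" for q j
    using sgn[OF that] s by (cases "even q") auto
  have disj: "X q \<inter> X q' = {}" if "q \<le> m" "q' \<le> m" "q \<noteq> q'" for q q'
    using that ord[of q q'] ord[of q' q] by (metis disjoint_iff less_irrefl linorder_neqE_nat)
  have "(\<Sum>j\<in>UNIV. a j * v j) = (\<Sum>j\<in>(\<Union>q\<le>m. X q). a j * v j)"
    using supp by (intro sum.mono_neutral_right) auto
  also have "\<dots> = (\<Sum>q\<le>m. \<Sum>j\<in>X q. a j * v j)"
    using disj by (intro sum.UNION_disjoint) auto
  also have "\<dots> = (\<Sum>q\<le>m. s * (-1) ^ q * (\<Sum>j\<in>X q. \<bar>v j\<bar> * a j))"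
    unfolding sum_distrib_left
  proof (intro sum.cong refl)
    fix q j assume "q \<in> {..m}" "j \<in> X q"
    then have "v j = s * (-1) ^ q * \<bar>v j\<bar>" by (intro v) auto
    from arg_cong[OF this, of "(*) (a j)"] show "a j * v j = s * (-1) ^ q * (\<bar>v j\<bar> * a j)"
      by (rule trans) (simp only: mult_ac)
  qed
  finally show ?thesis by (simp add: lessThan_Suc_atMost)
qed

text \<open>Summing the columns of each sign block with weights \<open>\<bar>z $ j\<bar>\<close> turns \<open>A *v z\<close>, restricted to
  the rows of the alternation, into \<open>B x\<close> with \<open>B\<close> square and \<open>x\<close> strictly alternating. Cramer's rule
  for the first entry of \<open>x\<close> then has a definite sign on one side and the opposite one on the
  other.\<close>

lemma totally_positive_sign_blocks:
  fixes A :: "real ^ 'n::{finite,linorder} ^ 'm::{finite,linorder}"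
  assumes TP: "totally_positive A"
    and blocks: "sign_blocks (\<lambda>j. z $ j) {j. z $ j \<noteq> 0} m X s"
  shows "\<not> weak_alternation (\<lambda>i. (A *v z) $ i) m (- s)"
proof
  assume "weak_alternation (\<lambda>i. (A *v z) $ i) m (- s)"
  then obtain r where r: "strict_mono_on {..m} r"
    and weak: "\<And>k. k \<le> m \<Longrightarrow> - s * (-1) ^ k * (A *v z) $ r k \<ge> 0"
    unfolding weak_alternation_def by blast
  have s: "s = 1 \<or> s = -1" and ne: "\<And>q. q < Suc m \<Longrightarrow> X q \<noteq> {}"
    and ord: "\<And>q q' j j'. q < q' \<Longrightarrow> q' < Suc m \<Longrightarrow> j \<in> X q \<Longrightarrow> j' \<in> X q' \<Longrightarrow> j < j'"
    and sgn: "\<And>q j. q < Suc m \<Longrightarrow> j \<in> X q \<Longrightarrow> s * (-1) ^ q * z $ j > 0"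
    using blocks unfolding sign_blocks_def less_Suc_eq_le by blast+
  have nz: "\<bar>z $ j\<bar> > 0" if "q < Suc m" "j \<in> X q" for q j
    using sgn[OF that] by (cases "z $ j = 0") auto
  define B where "B = Matrix.mat (Suc m) (Suc m) (\<lambda>(p, q). \<Sum>j\<in>X q. \<bar>z $ j\<bar> * A $ r p $ j)"
  have B: "B \<in> carrier_mat (Suc m) (Suc m)" by (simp add: B_def)
  have rM: "strict_mono_on {..<Suc m} r" using r by (simp add: lessThan_Suc_atMost)
  have det_B: "Determinant.det B > 0"
    unfolding B_def
    by (rule totally_positive_det_blocks_pos[OF TP rM ord ne nz])
  have det_delete: "Determinant.det (mat_delete B p 0) > 0" if p: "p \<le> m" for p
  proof -
    \<comment> \<open>\<open>r'\<close> skips row \<open>p\<close>, and deleting column 0 shifts the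
      blocks by one, so the smaller matrix again consists of weighted block sums.\<close>
    define r' where "r' k = r (if k < p then k else Suc k)" for k
    have "mat_delete B p 0 =
        Matrix.mat m m (\<lambda>(p, q). \<Sum>j\<in>X (Suc q). \<bar>z $ j\<bar> * A $ r' p $ j)"
      unfolding mat_delete_def B_def r'_def by auto
    moreover have "strict_mono_on {..<m} r'"
      unfolding r'_def by (intro strict_mono_onI strict_mono_onD[OF r]) auto
    then have "Determinant.det (Matrix.mat m m
        (\<lambda>(p, q). \<Sum>j\<in>X (Suc q). \<bar>z $ j\<bar> * A $ r' p $ j)) > 0"
    proof (rule totally_positive_det_blocks_pos[OF TP])
      show "j < j'" if "q < q'" "q' < m" "j \<in> X (Suc q)" "j' \<in> X (Suc q')" for q q' j j'
        using ord[OF _ _ that(3,4)] that(1,2) by simp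
      show "X (Suc q) \<noteq> {}" if "q < m" for q using ne that by simp
      show "\<bar>z $ j\<bar> > 0" if "q < m" "j \<in> X (Suc q)" for q j using nz[OF _ that(2)] that(1) by simp
    qed
    ultimately show ?thesis by simp
  qed
  have Az: "(A *v z) $ r p = (\<Sum>q<Suc m. s * (-1) ^ q * B $$ (p, q))" if "p < Suc m" for p
    using sum_over_sign_blocks[OF blocks, of "\<lambda>j. A $ r p $ j"] that
    by (simp add: matrix_vector_mult_def B_def)
  \<comment> \<open>This is the first row of \<open>adj_mat B * B\<close>, which is the determinant
    times the identity. It eliminates every block except the first.\<close>
  have cof: "(\<Sum>p<Suc m. cofactor B p 0 * B $$ (p, q)) =
      (if q = 0 then Determinant.det B else 0)" if "q < Suc m" for q
  proof -
    have "(adj_mat B * B) $$ (0, q) = (\<Sum>p<Suc m. cofactor B p 0 * B $$ (p, q))"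
      using that B by (simp add: adj_mat_def scalar_prod_def atLeast0LessThan)
    then show ?thesis using that unfolding adj_mat(3)[OF B]
      by (simp del: sum.lessThan_Suc split: if_splits)
  qed
  have "(\<Sum>p<Suc m. cofactor B p 0 * (A *v z) $ r p) =
      (\<Sum>p<Suc m. \<Sum>q<Suc m. s * (-1) ^ q * (cofactor B p 0 * B $$ (p, q)))"
  proof (intro sum.cong refl)
    fix p assume "p \<in> {..<Suc m}"
    then have "p < Suc m" by simp
    show "cofactor B p 0 * (A *v z) $ r p =
        (\<Sum>q<Suc m. s * (-1) ^ q * (cofactor B p 0 * B $$ (p, q)))"
      unfolding Az[OF \<open>p < Suc m\<close>] sum_distrib_left by (simp only: mult.left_commute)
  qed
  also have "\<dots> = (\<Sum>q<Suc m. s * (-1) ^ q * (\<Sum>p<Suc m. cofactor B p 0 * B $$ (p, q)))"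
    unfolding sum_distrib_left by (rule sum.swap)
  also have "\<dots> = (\<Sum>q<Suc m. if q = 0 then s * Determinant.det B else 0)"
  proof (intro sum.cong refl)
    fix q assume "q \<in> {..<Suc m}"
    then have "q < Suc m" by simp
    show "s * (-1) ^ q * (\<Sum>p<Suc m. cofactor B p 0 * B $$ (p, q)) =
        (if q = 0 then s * Determinant.det B else 0)"
      unfolding cof[OF \<open>q < Suc m\<close>] by simp
  qed
  also have "\<dots> = s * Determinant.det B"
    by (subst sum.delta) auto
  finally have eq: "(\<Sum>p<Suc m. cofactor B p 0 * (A *v z) $ r p) = s * Determinant.det B" .
  \<comment> \<open>The cofactor sign \<open>(-1) ^ p\<close> matches the assumed alternation, so
    every summand is at most 0, while the total is the positive determinant of
    \<open>B\<close>.\<close>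
  have "Determinant.det B = s * (s * Determinant.det B)" using s by auto
  also have "\<dots> = (\<Sum>p<Suc m. s * (-1) ^ p * (A *v z) $ r p * Determinant.det (mat_delete B p 0))"
    unfolding eq[symmetric] sum_distrib_left cofactor_def
    by (intro sum.cong refl) (simp add: mult_ac)
  also have "\<dots> \<le> 0"
  proof (rule sum_nonpos)
    fix p assume "p \<in> {..<Suc m}"
    then have "p \<le> m" by simp
    from weak[OF this] det_delete[OF this]
    show "s * (-1) ^ p * (A *v z) $ r p * Determinant.det (mat_delete B p 0) \<le> 0"
      by (intro mult_nonpos_nonneg[of "s * (-1) ^ p * (A *v z) $ r p"]) simp_all
  qed
  finally show False using det_B by simp
qed

text \<open>One block decomposition of the support of \<open>z\<close> supplies both conclusions,
  hence the same \<open>m\<close> and \<open>s\<close> in each.\<close>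

lemma totally_positive_alternation:
  fixes A :: "real ^ 'n::{finite,linorder} ^ 'm::{finite,linorder}"
  assumes TP: "totally_positive A" and z: "z \<noteq> 0"
  obtains m s where "s = 1 \<or> s = -1" "strict_alternation (\<lambda>j. z $ j) m s"
    "\<not> weak_alternation (\<lambda>i. (A *v z) $ i) m (- s)"
proof -
  from z have ne: "{j. z $ j \<noteq> 0} \<noteq> {}" by (auto simp: Finite_Cartesian_Product.vec_eq_iff)
  have "\<exists>m X s. sign_blocks (\<lambda>j. z $ j) {j. z $ j \<noteq> 0} m X s"
    by (rule sign_blocks_exist[OF _ ne]) simp_all
  then obtain m X s where blocks: "sign_blocks (\<lambda>j. z $ j) {j. z $ j \<noteq> 0} m X s"
    by blast
  then have "s = 1 \<or> s = -1" unfolding sign_blocks_def by blast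
  then show thesis
    by (rule that[OF _ strict_alternation_of_sign_blocks[OF blocks]
          totally_positive_sign_blocks[OF TP blocks]])
qed

text \<open>A zero image would weakly alternate, with either sign, along the very indices where
  \<open>z\<close> strictly alternates.\<close>

lemma totally_positive_mult_nonzero:
  fixes A :: "real ^ 'n::{finite,linorder} ^ 'n::{finite,linorder}"
  assumes "totally_positive A" "z \<noteq> 0"
  shows "A *v z \<noteq> 0"
proof
  assume 0: "A *v z = 0"
  from totally_positive_alternation[OF assms] obtain m s
    where "strict_alternation (\<lambda>j. z $ j) m s" and no: "\<not> weak_alternation (\<lambda>i. (A *v z) $ i) m (- s)"
    by blast
  then show False unfolding strict_alternation_def weak_alternation_def by (auto simp: 0)
qed

text \<open>Variation diminution with control of the starting sign. Let \<open>z\<close> alternate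
  \<open>m\<close> times from \<open>s\<close>. If \<open>t = s\<close>, then \<open>k > m\<close>
  would leave a forbidden tail starting with \<open>- s\<close>, so shortening the alternation of
  \<open>z\<close> suffices. If \<open>t = - s\<close>, then \<open>k \<ge> m\<close> is forbidden
  outright, and a tail of the alternation of \<open>z\<close> starts with \<open>t\<close>.\<close>

lemma totally_positive_weak_imp_strict:
  fixes A :: "real ^ 'n::{finite,linorder} ^ 'm::{finite,linorder}"
  assumes TP: "totally_positive A" and z: "z \<noteq> 0" and t: "t = 1 \<or> t = -1"
    and weak: "weak_alternation (\<lambda>i. (A *v z) $ i) k t"
  shows "strict_alternation (\<lambda>j. z $ j) k t"
proof -
  from totally_positive_alternation[OF TP z] obtain m s where s: "s = 1 \<or> s = (-1::real)"
    and strict: "strict_alternation (\<lambda>j. z $ j) m s"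
    and no: "\<not> weak_alternation (\<lambda>i. (A *v z) $ i) m (- s)" by blast
  from s t consider "t = s" | "t = - s" by auto
  then show ?thesis
  proof cases
    case 1
    have "k \<le> m"
    proof (rule ccontr)
      assume "\<not> k \<le> m"
      then show False
        using weak_alternation_tail[OF weak_alternation_le[OF weak, of "Suc m"]] no 1 by simp
    qed
    then show ?thesis using strict_alternation_le[OF strict] 1 by simp
  next
    case 2
    have "k < m"
    proof (rule ccontr)
      assume "\<not> k < m"
      then show False using weak_alternation_le[OF weak, of m] no 2 by simp
    qed
    then show ?thesis
      using strict_alternation_tail[OF strict_alternation_le[OF strict, of "Suc k"]] 2 by simp
  qed
qed

section \<open>Eventual sign of the first coordinate\<close>

text \<open>The first coordinate does not have the sign of \<open>s\<close>, so its index lies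
  strictly before the alternation and can be prepended to it.\<close>

lemma weak_alternation_Min:
  fixes v :: "'n::{finite,linorder} \<Rightarrow> real"
  assumes "strict_alternation v m s" and le: "s * v (Min UNIV) \<le> 0"
  shows "weak_alternation v (Suc m) (- s)"
proof -
  from assms obtain r where r: "strict_mono_on {..m} r"
    and pos: "\<And>k. k \<le> m \<Longrightarrow> s * (-1) ^ k * v (r k) > 0" unfolding strict_alternation_def by blast
  have "Min UNIV \<noteq> r 0" using pos[of 0] le by auto
  then have "Min UNIV < r 0" by (simp add: order_less_le)
  moreover have "r 0 \<le> r k" if "k \<le> m" for k
    using that strict_mono_on_leD[OF r, of 0 k] by simp
  ultimately have first: "Min UNIV < r k" if "k \<le> m" for k
    using that by (meson order_less_le_trans)
  let ?r = "case_nat (Min UNIV) r"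
  have "strict_mono_on {..Suc m} ?r"
    using first strict_mono_onD[OF r] by (auto intro!: strict_mono_onI split: nat.split)
  moreover have "- s * (-1) ^ k * v (?r k) \<ge> 0" if "k \<le> Suc m" for k
  proof (cases k)
    case 0
    then show ?thesis using le by simp
  next
    case (Suc k')
    then show ?thesis using pos[of k'] that by simp
  qed
  ultimately show ?thesis unfolding weak_alternation_def by blast
qed

text \<open>The set of strict alternations of \<open>d k\<close> decreases with \<open>k\<close>. Once a maximal one is stable, the
  first coordinate must share its sign, since it would otherwise prolong it.\<close>

lemma totally_positive_eventual_sign:
  fixes d :: "nat \<Rightarrow> real ^ 'n::{finite,linorder}"
  assumes step: "\<And>k. \<exists>A. totally_positive A \<and> d (Suc k) = A *v d k" and d0: "d 0 \<noteq> 0"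
  obtains s N where "\<And>k. k \<ge> N \<Longrightarrow> s * d k $ Min UNIV > (0::real)"
proof -
  have nz: "d k \<noteq> 0" for k
  proof (induction k)
    case (Suc k)
    from step[of k] obtain A where "totally_positive A" "d (Suc k) = A *v d k" by blast
    then show ?case using totally_positive_mult_nonzero[OF _ Suc] by simp
  qed (rule d0)
  \<comment> \<open>Going one step back in time turns a weak alternation into a strict one;
    \<open>anti\<close> iterates this for strict ones.\<close>
  have pull: "strict_alternation (\<lambda>j. d k $ j) m t"
    if "weak_alternation (\<lambda>j. d (Suc k) $ j) m t" "t = 1 \<or> t = -1" for k m t
  proof -
    from step[of k] obtain A where "totally_positive A" "d (Suc k) = A *v d k" by blast
    then show ?thesis using totally_positive_weak_imp_strict[OF _ nz[of k] that(2)] that(1) by simp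
  qed
  have anti: "strict_alternation (\<lambda>j. d k $ j) m t"
    if "strict_alternation (\<lambda>j. d k' $ j) m t" "k \<le> k'" "t = 1 \<or> t = -1" for k k' m t
    using that(2,1)
  proof (induction rule: dec_induct)
    case (step i)
    then show ?case using pull[OF strict_alternation_imp_weak that(3)] by blast
  qed
  \<comment> \<open>The sign must be the same at all times. For \<open>m = 0\<close>, a nonzero
    entry at a late time has some sign, which \<open>anti\<close> carries back to all earlier
    times.\<close>
  define P where "P m \<longleftrightarrow> (\<exists>s. (s = 1 \<or> s = -1) \<and> (\<forall>k. strict_alternation (\<lambda>j. d k $ j) m s))" for m
  have "P 0"
  proof (rule ccontr)
    assume "\<not> P 0"
    then obtain k1 k2 where no: "\<not> strict_alternation (\<lambda>j. d k1 $ j) 0 1"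
      "\<not> strict_alternation (\<lambda>j. d k2 $ j) 0 (-1)" unfolding P_def by blast
    from nz[of "max k1 k2"] obtain j where j: "d (max k1 k2) $ j \<noteq> 0" by (auto simp: Finite_Cartesian_Product.vec_eq_iff)
    have "strict_alternation (\<lambda>j. d (max k1 k2) $ j) 0 (sgn (d (max k1 k2) $ j))"
      unfolding strict_alternation_def using j
      by (intro exI[of _ "\<lambda>_. j"]) (auto intro!: strict_mono_onI simp: sgn_if)
    then show False
      using no anti[of "max k1 k2" 0 1 k1] anti[of "max k1 k2" 0 "-1" k2] j
      by (auto simp: sgn_if split: if_splits)
  qed
  have "\<not> P CARD('n)" unfolding P_def using strict_alternation_less_card by blast
  with \<open>P 0\<close> obtain m where m: "P m" "\<not> P (Suc m)" by (metis nat_induct)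
  then obtain s where s: "s = 1 \<or> s = -1" and strict: "\<And>k. strict_alternation (\<lambda>j. d k $ j) m s"
    unfolding P_def by blast
  from s have s': "- s = 1 \<or> - s = -1" by auto
  with m(2) obtain N where N: "\<not> strict_alternation (\<lambda>j. d N $ j) (Suc m) (- s)"
    unfolding P_def by blast
  \<comment> \<open>The bound is \<open>Suc N\<close> because the prolonged alternation is only
    weak: one step back makes it strict, and the time reached must still be at least
    \<open>N\<close>.\<close>
  have "s * d k $ Min UNIV > 0" if k: "k \<ge> Suc N" for k
  proof (rule ccontr)
    assume "\<not> s * d k $ Min UNIV > 0"
    then have "weak_alternation (\<lambda>j. d k $ j) (Suc m) (- s)"
      using weak_alternation_Min[OF strict[of k]] by simp
    moreover obtain k' where k': "k = Suc k'" "N \<le> k'" using k by (cases k) auto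
    ultimately have "strict_alternation (\<lambda>j. d k' $ j) (Suc m) (- s)" using pull[OF _ s'] by simp
    from anti[OF this k'(2) s'] N show False by simp
  qed
  then show thesis by (rule that)
qed

section \<open>Averaged Jacobians\<close>

text \<open>The fundamental theorem of calculus along the segment from \<open>b\<close> to
  \<open>a\<close>, which stays in \<open>S\<close> by convexity. Applying a matrix to
  \<open>a - b\<close> is linear in the matrix and so commutes with the integral.\<close>

lemma C1_around_mean_value:
  fixes g :: "real ^ 'n \<Rightarrow> real ^ 'm"
  assumes C1: "C1_around g S" and S: "convex S" and ab: "a \<in> S" "b \<in> S"
  shows "g a - g b =
    integral {0..1} (\<lambda>r. jacobian g (at (r *\<^sub>R a + (1 - r) *\<^sub>R b))) *v (a - b)"
proof -
  from C1 obtain U where U: "open U" "S \<subseteq> U"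
    and diff: "\<And>x. x \<in> U \<Longrightarrow> g differentiable (at x)"
    and cont: "continuous_on U (\<lambda>x. jacobian g (at x))"
    unfolding C1_around_def by blast
  define c where "c r = r *\<^sub>R a + (1 - r) *\<^sub>R b" for r :: real
  have c: "c r \<in> U" if "r \<in> {0..1}" for r
    using convexD[OF S ab, of r "1 - r"] that U(2) by (auto simp: c_def)
  have c': "(c has_vector_derivative (a - b)) (at r within {0..1})" for r
    unfolding c_def by (auto intro!: derivative_eq_intros simp: scaleR_diff_left)
  have "continuous_on {0..1} c" unfolding c_def by (intro continuous_intros)
  then have "continuous_on {0..1} (\<lambda>r. jacobian g (at (c r)))"
    by (rule continuous_on_compose2[OF cont]) (use c in auto)
  then have "((\<lambda>r. jacobian g (at (c r))) has_integral
      integral {0..1} (\<lambda>r. jacobian g (at (c r)))) {0..1}"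
    by (intro integrable_integral integrable_continuous_real)
  moreover have "bounded_linear (\<lambda>M. M *v (a - b) :: real ^ 'm)"
    unfolding linear_conv_bounded_linear[symmetric]
    by (intro linearI matrix_vector_mult_add_rdistrib) (simp add: scaleR_matrix_vector_assoc)
  ultimately have "((\<lambda>r. jacobian g (at (c r)) *v (a - b)) has_integral
      integral {0..1} (\<lambda>r. jacobian g (at (c r))) *v (a - b)) {0..1}"
    by (rule has_integral_linear[unfolded o_def])
  moreover have "((\<lambda>r. jacobian g (at (c r)) *v (a - b)) has_integral g (c 1) - g (c 0)) {0..1}"
  proof (rule fundamental_theorem_of_calculus)
    fix r :: real assume "r \<in> {0..1}"
    then have "(g has_derivative (\<lambda>h. jacobian g (at (c r)) *v h)) (at (c r))"
      using diff[OF c] jacobian_works by blast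
    then have "((g \<circ> c) has_vector_derivative jacobian g (at (c r)) *v (a - b))
        (at r within {0..1})"
      by (intro vector_derivative_diff_chain_within[OF c']) (rule has_derivative_at_withinI)
    then show "((\<lambda>r. g (c r)) has_vector_derivative jacobian g (at (c r)) *v (a - b))
        (at r within {0..1})" by (simp add: o_def)
  qed simp
  ultimately have "integral {0..1} (\<lambda>r. jacobian g (at (c r))) *v (a - b) = g (c 1) - g (c 0)"
    by (rule has_integral_unique)
  then show ?thesis by (simp add: c_def)
qed

lemma C1_around_continuous_on:
  assumes "C1_around g S"
  shows "continuous_on S g"
proof -
  from assms obtain U where "S \<subseteq> U" "\<forall>x\<in>U. g differentiable (at x)"
    unfolding C1_around_def by blast
  then show ?thesis
    by (meson continuous_at_imp_continuous_on differentiable_imp_continuous_within subsetD)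
qed

section \<open>Limits of iterates\<close>

text \<open>Otherwise some subsequence stays away from \<open>p\<close>; by compactness it has a
  convergent subsequence, whose limit would have to be \<open>p\<close>.\<close>

lemma compact_tendsto_of_unique_limit_point:
  fixes u :: "nat \<Rightarrow> 'a::metric_space"
  assumes "compact S" and u: "\<And>k. u k \<in> S"
    and unique: "\<And>r q. strict_mono r \<Longrightarrow> (u \<circ> r) \<longlonglongrightarrow> q \<Longrightarrow> q = p"
  shows "u \<longlonglongrightarrow> p"
proof (rule ccontr)
  assume "\<not> u \<longlonglongrightarrow> p"
  then obtain e where e: "e > 0" and far: "\<exists>\<^sub>F k in sequentially. dist (u k) p \<ge> e"
    unfolding tendsto_iff by (auto simp: not_eventually not_less)
  then have "infinite {k. dist (u k) p \<ge> e}"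
    by (simp add: frequently_cofinite[symmetric] cofinite_eq_sequentially)
  then obtain r :: "nat \<Rightarrow> nat" where r: "strict_mono r" "\<And>k. dist (u (r k)) p \<ge> e"
    using infinite_enumerate by blast
  have "\<forall>k. (u \<circ> r) k \<in> S" using u by simp
  with \<open>compact S\<close> obtain q r' where r': "strict_mono r'" "((u \<circ> r) \<circ> r') \<longlonglongrightarrow> q"
    unfolding compact_def by blast
  then have "q = p"
    using unique[OF strict_mono_o[OF r(1) r'(1)]] by (simp add: o_assoc)
  with r'(2) e have "\<forall>\<^sub>F k in sequentially. dist (((u \<circ> r) \<circ> r') k) p < e"
    by (auto simp: tendsto_iff)
  then show False using r(2) by (simp add: not_le[symmetric])
qed

text \<open>If the \<open>\<phi>\<close>-values of distinct orbits are eventually strictly ordered, then \<open>\<phi>\<close> is eventually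
  monotone along the orbit of \<open>a\<close>, hence constant on its limit set; but that set is invariant, so
  all of its points must be equal.\<close>

lemma funpow_tendsto_fixed_point:
  fixes F :: "'a::metric_space \<Rightarrow> 'a" and \<phi> :: "'a \<Rightarrow> real"
  assumes S: "compact S" and F: "continuous_on S F" "F ` S \<subseteq> S" and \<phi>: "continuous_on S \<phi>"
    and sep: "\<And>p q. p \<in> S \<Longrightarrow> q \<in> S \<Longrightarrow> p \<noteq> q \<Longrightarrow>
      \<exists>s N. \<forall>k\<ge>N. s * (\<phi> ((F ^^ k) p) - \<phi> ((F ^^ k) q)) > 0"
    and a: "a \<in> S"
  obtains p where "p \<in> S" "F p = p" "(\<lambda>k. (F ^^ k) a) \<longlonglongrightarrow> p"
proof -
  define u where "u k = (F ^^ k) a" for k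
  have funpow_S: "(F ^^ k) x \<in> S" if "x \<in> S" for k x
    using that F(2) by (induction k) auto
  then have u_S: "u k \<in> S" for k unfolding u_def using a .
  have cont_pow: "continuous_on S (F ^^ k)" for k
  proof (induction k)
    case (Suc k)
    have "continuous_on S (F \<circ> (F ^^ k))"
      by (intro continuous_on_compose Suc continuous_on_subset[OF F(1)]) (use funpow_S in auto)
    then show ?case by simp
  qed (simp add: continuous_on_id)
  have "bounded (\<phi> ` S)" using S \<phi> by (intro compact_imp_bounded compact_continuous_image)
  then obtain K where K: "\<And>x. x \<in> S \<Longrightarrow> \<bar>\<phi> x\<bar> \<le> K"
    unfolding bounded_iff by auto
  obtain L where L: "(\<lambda>k. \<phi> (u k)) \<longlonglongrightarrow> L"
  proof (cases "F a = a")
    case True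
    then have "u k = a" for k unfolding u_def by (induction k) auto
    then have "(\<lambda>k. \<phi> (u k)) \<longlonglongrightarrow> \<phi> a" by simp
    then show thesis by (rule that)
  next
    case False
    \<comment> \<open>The orbits of \<open>F a\<close> and \<open>a\<close> are consecutive terms of
      \<open>u\<close>, so up to the factor \<open>s\<close> the values \<open>\<phi> (u k)\<close>
      eventually increase; they are bounded by \<open>K\<close>.\<close>
    from sep[OF _ a False] F(2) a obtain s N
      where sN: "\<forall>k\<ge>N. s * (\<phi> ((F ^^ k) (F a)) - \<phi> ((F ^^ k) a)) > 0" by blast
    have inc: "s * \<phi> (u k) < s * \<phi> (u (Suc k))" if "k \<ge> N" for k
      using sN that by (simp add: u_def funpow_swap1 algebra_simps)
    have s: "s \<noteq> 0" using inc[of N] by auto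
    have "incseq (\<lambda>k. s * \<phi> (u (k + N)))"
      using inc by (intro incseq_SucI) (simp add: less_imp_le)
    moreover have "Bseq (\<lambda>k. s * \<phi> (u (k + N)))"
      using K[OF u_S] by (intro BseqI'[of _ "\<bar>s\<bar> * K"]) (auto simp: abs_mult intro: mult_left_mono)
    ultimately have "convergent (\<lambda>k. s * \<phi> (u (k + N)))"
      by (intro Bseq_monoseq_convergent incseq_imp_monoseq)
    then obtain L where "(\<lambda>k. s * \<phi> (u (k + N))) \<longlonglongrightarrow> L" unfolding convergent_def by blast
    then have "(\<lambda>k. \<phi> (u (k + N))) \<longlonglongrightarrow> L / s"
      using tendsto_divide[OF _ tendsto_const[of s]] s by fastforce
    then show thesis by (rule that[OF LIMSEQ_offset])
  qed
  have lim: "q \<in> S \<and> F q = q \<and> \<phi> q = L" if r: "strict_mono r" and q: "(u \<circ> r) \<longlonglongrightarrow> q" for r q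
  proof -
    have qS: "q \<in> S"
      using closed_sequentially[OF compact_imp_closed[OF S] _ q] u_S by simp
    \<comment> \<open>Since \<open>(F ^^ k) (u (r j)) = u (k + r j)\<close>, the value at the limit
      is again a limit along indices tending to infinity.\<close>
    have orbit: "\<phi> ((F ^^ k) q) = L" for k
    proof -
      have "continuous_on S (\<lambda>x. \<phi> ((F ^^ k) x))"
        by (intro continuous_on_compose2[OF \<phi> cont_pow]) (use funpow_S in auto)
      from continuous_on_tendsto_compose[OF this q qS]
      have "(\<lambda>j. \<phi> (u (k + r j))) \<longlonglongrightarrow> \<phi> ((F ^^ k) q)"
        using u_S by (simp add: u_def funpow_add)
      moreover have "filterlim (\<lambda>j. k + r j) at_top sequentially"
        using filterlim_subseq[OF r] filterlim_at_top_mono by fastforce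
      then have "(\<lambda>j. \<phi> (u (k + r j))) \<longlonglongrightarrow> L" by (rule filterlim_compose[OF L])
      ultimately show ?thesis using LIMSEQ_unique by blast
    qed
    have "F q = q"
    proof (rule ccontr)
      assume "F q \<noteq> q"
      from sep[OF _ qS this] F(2) qS obtain s N
        where "\<forall>k\<ge>N. s * (\<phi> ((F ^^ k) (F q)) - \<phi> ((F ^^ k) q)) > 0" by blast
      then have "s * (\<phi> ((F ^^ Suc N) q) - \<phi> ((F ^^ N) q)) > 0"
        by (auto simp: funpow_swap1)
      then show False unfolding orbit by simp
    qed
    then show ?thesis using qS orbit[of 0] by simp
  qed
  obtain p r where p: "strict_mono r" "(u \<circ> r) \<longlonglongrightarrow> p"
    using S u_S unfolding compact_def by blast
  have "u \<longlonglongrightarrow> p"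
  proof (rule compact_tendsto_of_unique_limit_point[OF S u_S])
    fix r' q assume "strict_mono r'" "(u \<circ> r') \<longlonglongrightarrow> q"
    note q = lim[OF this] and p = lim[OF p]
    \<comment> \<open>Both points are fixed with \<open>\<phi>\<close>-value \<open>L\<close>, so
      the strict inequality from \<open>sep\<close> would compare \<open>L\<close> with
      itself.\<close>
    show "q = p"
    proof (rule ccontr)
      assume "q \<noteq> p"
      with sep[of q p] p q obtain s N
        where "\<forall>k\<ge>N. s * (\<phi> ((F ^^ k) q) - \<phi> ((F ^^ k) p)) > 0" by blast
      moreover have "(F ^^ N) q = q" "(F ^^ N) p = p" using p q by (induction N) auto
      ultimately show False using p q by auto
    qed
  qed
  then show thesis using that lim[OF p] unfolding u_def by blast
qed

section \<open>Trajectories of periodic systems\<close>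

lemma trajectory_in:
  assumes "\<And>i. f i ` S \<subseteq> S" "a \<in> S"
  shows "trajectory f a i \<in> S"
  using assms by (induction i) auto

lemma continuous_on_trajectory:
  assumes "\<And>i. continuous_on S (f i)" "\<And>i. f i ` S \<subseteq> S"
  shows "continuous_on S (\<lambda>a. trajectory f a i)"
proof (induction i)
  case (Suc i)
  show ?case unfolding trajectory.simps
    by (rule continuous_on_compose2[OF assms(1) Suc]) (use trajectory_in[of f S] assms(2) in blast)
qed (simp add: continuous_on_id)

text \<open>From time \<open>T\<close> on, the same maps are applied in the same order as from time
  0.\<close>

lemma trajectory_add_period:
  assumes inv: "\<And>i. f i ` S \<subseteq> S" and per: "\<And>i a. a \<in> S \<Longrightarrow> f (i + T) a = f i a"
    and a: "a \<in> S"
  shows "trajectory f a (i + T) = trajectory f (trajectory f a T) i"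
proof (induction i)
  case (Suc i)
  then show ?case using per[OF trajectory_in[of f S a "i + T", OF inv a], of i] by simp
qed simp

lemma trajectory_add_multiple_period:
  assumes inv: "\<And>i. f i ` S \<subseteq> S" and per: "\<And>i a. a \<in> S \<Longrightarrow> f (i + T) a = f i a"
    and a: "a \<in> S"
  shows "trajectory f a (i + k * T) = trajectory f (((\<lambda>a. trajectory f a T) ^^ k) a) i"
proof (induction k arbitrary: i)
  case (Suc k)
  have "((\<lambda>a. trajectory f a T) ^^ k) a \<in> S"
    using Suc[of 0] trajectory_in[of f S, OF inv a, of "k * T"] by simp
  from trajectory_add_period[of f S T, OF inv per this] Suc[of "i + T"]
  show ?case by (simp add: add.assoc)
qed simp

text \<open>There are finitely many residues modulo \<open>T\<close>, so one threshold for the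
  quotient \<open>i div T\<close> serves them all.\<close>

lemma tendsto_of_residue_classes:
  fixes d :: "nat \<Rightarrow> 'a::metric_space"
  assumes T: "T > 0" and lim: "\<And>j. j < T \<Longrightarrow> (\<lambda>k. d (j + k * T)) \<longlonglongrightarrow> l"
  shows "d \<longlonglongrightarrow> l"
proof (rule tendstoI)
  fix e :: real assume "e > 0"
  then have "\<forall>\<^sub>F k in sequentially. \<forall>j\<in>{..<T}. dist (d (j + k * T)) l < e"
    using lim by (intro eventually_ball_finite) (auto simp: tendsto_iff)
  moreover have "filterlim (\<lambda>i. i div T) sequentially sequentially"
    unfolding filterlim_at_top
  proof
    fix Z
    have "Z \<le> i div T" if "i \<ge> Z * T" for i using div_le_mono[OF that, of T] T by simp
    then show "\<forall>\<^sub>F i in sequentially. Z \<le> i div T" by (rule eventually_sequentiallyI)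
  qed
  ultimately have "\<forall>\<^sub>F i in sequentially. \<forall>j\<in>{..<T}. dist (d (j + (i div T) * T)) l < e"
    by (rule eventually_compose_filterlim)
  then show "\<forall>\<^sub>F i in sequentially. dist (d i) l < e"
    by (rule eventually_mono) (metis T lessThan_iff mod_less_divisor mod_mult_div_eq add.commute mod_div_mult_eq)
qed

theorem theorem7:
  fixes f :: "nat \<Rightarrow> real ^ 'n::{finite,linorder} \<Rightarrow> real ^ 'n::{finite,linorder}"
    and \<Omega> :: "(real ^ 'n::{finite,linorder}) set"
    and T :: nat
  assumes C1: "\<And>i. C1_around (f i) \<Omega>"
    and convex: "convex \<Omega>"
    and compact: "compact \<Omega>"
    and invariant: "\<And>i. f i ` \<Omega> \<subseteq> \<Omega>"
    and TP: "\<And>i a b. a \<in> \<Omega> \<Longrightarrow> b \<in> \<Omega> \<Longrightarrow>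
      totally_positive
        (integral {0..1} (\<lambda>r. jacobian (f i) (at (r *\<^sub>R a + (1 - r) *\<^sub>R b))))"
    and T_pos: "T > 0"
    and T_periodic: "\<And>i a. a \<in> \<Omega> \<Longrightarrow> f (i + T) a = f i a"
  shows "\<forall>a\<in>\<Omega>. \<exists>y. is_solution f y \<and> (\<forall>i. y i \<in> \<Omega>) \<and> (\<forall>i. y (i + T) = y i) \<and>
    (\<lambda>i. trajectory f a i - y i) \<longlonglongrightarrow> 0"
proof
  fix a assume a: "a \<in> \<Omega>"
  \<comment> \<open>The period map, whose fixed points in \<open>\<Omega>\<close> start the
    \<open>T\<close>-periodic solutions.\<close>
  define F where "F = (\<lambda>a. trajectory f a T)"
  note traj_in = trajectory_in[of f \<Omega>, OF invariant]
  have cont: "continuous_on \<Omega> (\<lambda>a. trajectory f a i)" for i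
    by (rule continuous_on_trajectory[OF C1_around_continuous_on[OF C1] invariant])
  have shift: "trajectory f p (i + k * T) = trajectory f ((F ^^ k) p) i" if "p \<in> \<Omega>" for p i k
    unfolding F_def
    using trajectory_add_multiple_period[of f \<Omega>, OF invariant T_periodic that] .
  have sep: "\<exists>s N. \<forall>k\<ge>N. s * ((F ^^ k) p $ Min UNIV - (F ^^ k) q $ Min UNIV) > 0"
    if pq: "p \<in> \<Omega>" "q \<in> \<Omega>" "p \<noteq> q" for p q
  proof -
    define d where "d k = trajectory f p k - trajectory f q k" for k
    have "\<exists>A. totally_positive A \<and> d (Suc k) = A *v d k" for k
      using TP[OF traj_in[OF pq(1)] traj_in[OF pq(2)]]
        C1_around_mean_value[OF C1 convex traj_in[OF pq(1)] traj_in[OF pq(2)]]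
      by (auto simp: d_def)
    moreover have "d 0 \<noteq> 0" using pq by (simp add: d_def)
    ultimately obtain s N where sN: "\<And>k. k \<ge> N \<Longrightarrow> s * d k $ Min UNIV > (0::real)"
      by (rule totally_positive_eventual_sign) blast
    have "s * ((F ^^ k) p $ Min UNIV - (F ^^ k) q $ Min UNIV) > 0" if "k \<ge> N" for k
    proof -
      \<comment> \<open>The sign is known at all late times and is sampled at multiples of the
        period; \<open>T > 0\<close> gives \<open>k * T \<ge> k\<close>.\<close>
      have "k * T \<ge> N" using that T_pos mult_le_mono[of N k 1 T] by simp
      from sN[OF this] show ?thesis
        using shift[OF pq(1), of 0 k] shift[OF pq(2), of 0 k] by (simp add: d_def)
    qed
    then show ?thesis by blast
  qed
  have F: "continuous_on \<Omega> F" "F ` \<Omega> \<subseteq> \<Omega>"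
    unfolding F_def using cont traj_in by auto
  have "continuous_on \<Omega> (\<lambda>x. x $ Min UNIV)" by (intro continuous_intros)
  from funpow_tendsto_fixed_point[OF compact F this sep a] obtain p
    where p: "p \<in> \<Omega>" "F p = p" and lim: "(\<lambda>k. (F ^^ k) a) \<longlonglongrightarrow> p" by blast
  have p_period: "trajectory f p (i + k * T) = trajectory f p i" for i k
  proof -
    have "(F ^^ k) p = p" using p(2) by (induction k) auto
    then show ?thesis by (simp add: shift[OF p(1)])
  qed
  \<comment> \<open>On the class of times \<open>j + k * T\<close>, the orbit of \<open>a\<close> is
    the image of \<open>(F ^^ k) a\<close> under the continuous time-\<open>j\<close> map, and that
    of \<open>p\<close> is constant.\<close>
  have "(\<lambda>i. trajectory f a i - trajectory f p i) \<longlonglongrightarrow> 0"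
  proof (rule tendsto_of_residue_classes[OF T_pos])
    fix j
    have "(F ^^ k) a \<in> \<Omega>" for k using shift[OF a, of 0 k] traj_in[OF a, of "k * T"] by simp
    then have "(\<lambda>k. trajectory f ((F ^^ k) a) j) \<longlonglongrightarrow> trajectory f p j"
      by (intro continuous_on_tendsto_compose[OF cont lim p(1)]) auto
    from LIM_zero[OF this]
    show "(\<lambda>k. trajectory f a (j + k * T) - trajectory f p (j + k * T)) \<longlonglongrightarrow> 0"
      by (simp add: shift[OF a] p_period)
  qed
  moreover have "is_solution f (trajectory f p)" by (simp add: is_solution_def)
  moreover have "\<forall>i. trajectory f p (i + T) = trajectory f p i" using p_period[of _ 1] by simp
  ultimately show "\<exists>y. is_solution f y \<and> (\<forall>i. y i \<in> \<Omega>) \<and> (\<forall>i. y (i + T) = y i) \<and>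
      (\<lambda>i. trajectory f a i - y i) \<longlonglongrightarrow> 0"
    using traj_in[OF p(1)] by blast
qed

end
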